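(* Let $R$ be a commutative ring with $1$, let $n\geq 3$, $N=\binom{n}{2}$, and let $w$ be an arbitrary vector in $R^{N}$. For $j\in\{1,\dots,n\}$ set $$T_{*,j}:=\prod_{s\neq j}\bigwedge^{2}t_{s,j}\big(\mathrm{sgn}(s,j)\,w_{sj}\big),$$ where $s$ runs over $\{1,\dots,n\}\setminus\{j\}$. Then $T_{*,j}\cdot w=w$.
   Context: The coordinates of vectors in $R^N$ are indexed by the two-element subsets of $\{1,\dots,n\}$: $R^N$ is identified with $\bigwedge^{2}(R^n)$ via the basis $e_{a}\wedge e_{b}$, $a<b$, and for $s\neq j$ the symbol $w_{sj}=w_{js}$ denotes the coordinate of $w$ at $e_a\wedge e_b$, where $\{a,b\}=\{s,j\}$ and $a<b$. Put $\mathrm{sgn}(s,j)=+1$ if $s<j$ and $\mathrm{sgn}(s,j)=-1$ if $s>j$. The homomorphism $\bigwedge^{2}:\mathrm{GL}_n(R)\to\mathrm{GL}_N(R)$ is given by the action $g(e_a\wedge e_b)=(ge_a)\wedge(ge_b)$ on $\bigwedge^{2}(R^n)$. For $1\leq i\neq j\leq n$ and $\xi\in R$, $t_{i,j}(\xi)=e+\xi e_{i,j}\in\mathrm{GL}_n(R)$ is the elementary transvection ($e$ the identity matrix, $e_{i,j}$ the standard matrix unit), and $\bigwedge^{2}t_{i,j}(\xi)\in\mathrm{GL}_N(R)$ is its image. For fixed $j$ the factors in the product defining $T_{*,j}$ commute, so their order is irrelevant. *)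

theory Defs
  imports "Jordan_Normal_Form.Matrix"
begin

text \<open>
  Indices are 0-based: \<open>{..<n}\<close> replaces \<open>{1..n}\<close>, which changes neither the order
  of the indices nor, therefore, any sign. The sort \<open>{comm_ring, comm_monoid_mult}\<close> is that of
  commutative rings with 1; unlike \<open>comm_ring_1\<close> it does not exclude the zero ring.
\<close>

text \<open>
  The basis \<open>e_a \<and> e_b\<close> (\<open>a < b\<close>) of the exterior square is enumerated lexicographically,
  so that \<open>R^N\<close> becomes \<open>carrier_vec (n choose 2)\<close>.
\<close>

definition pairs :: "nat \<Rightarrow> (nat \<times> nat) list" where
  "pairs n = [(a, b). a \<leftarrow> [0..<n], b \<leftarrow> [Suc a..<n]]"

lemma set_pairs: "set (pairs n) = {(a, b). a < b \<and> b < n}"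
  by (force simp: pairs_def)

lemma distinct_pairs: "distinct (pairs n)"
proof -
  have "distinct (concat (map (\<lambda>a. map (Pair a) [Suc a..<n]) xs))" if "distinct xs" for xs
    using that
  proof (induction xs)
    case (Cons a xs)
    then have "distinct (concat (map (\<lambda>a. map (Pair a) [Suc a..<n]) xs))"
      by simp
    moreover have "distinct (map (Pair a) [Suc a..<n])"
      by (simp add: distinct_map inj_on_def)
    moreover have "a \<notin> set xs"
      using Cons.prems by simp
    ultimately show ?case
      by auto
  qed simp
  then show ?thesis
    by (simp add: pairs_def)
qed

lemma length_pairs: "length (pairs n) = n choose 2"
proof -
  have "length (pairs n) = card {(a, b). a < b \<and> b < n}"
    using distinct_card[OF distinct_pairs] set_pairs by metis
  also have "{(a, b). a < b \<and> b < n} = (SIGMA b:{..<n}. {..<b})\<inverse>"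
    by auto
  also have "card \<dots> = n choose 2"
    by (simp add: card_inverse choose_two Sum_Ico_nat lessThan_atLeast0)
  finally show ?thesis .
qed

lemma pairs_nthD:
  assumes "k < n choose 2" "pairs n ! k = (a, b)"
  shows "a < b" "b < n"
proof -
  have "(a, b) \<in> set (pairs n)"
    using assms nth_mem[of k "pairs n"] by (simp add: length_pairs)
  then show "a < b" "b < n"
    by (auto simp: set_pairs)
qed

lemma pairs_nth_eq_iff:
  "k < n choose 2 \<Longrightarrow> l < n choose 2 \<Longrightarrow> pairs n ! k = pairs n ! l \<longleftrightarrow> k = l"
  by (simp add: nth_eq_iff_index_eq[OF distinct_pairs] length_pairs)

definition coord2 :: "nat \<Rightarrow> 'a vec \<Rightarrow> nat \<Rightarrow> nat \<Rightarrow> 'a" where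
  "coord2 n w s j =
     w $ (THE k. k < length (pairs n) \<and> pairs n ! k = (min s j, max s j))"

lemma coord2_commute: "coord2 n w s j = coord2 n w j s"
  by (simp add: coord2_def min.commute max.commute)

lemma coord2_nth:
  assumes "k < n choose 2" "pairs n ! k = (a, b)"
  shows "coord2 n w a b = w $ k"
proof -
  have "(THE i. i < length (pairs n) \<and> pairs n ! i = (a, b)) = k"
  proof (rule the_equality)
    show "k < length (pairs n) \<and> pairs n ! k = (a, b)"
      using assms by (simp add: length_pairs)
  next
    fix i assume "i < length (pairs n) \<and> pairs n ! i = (a, b)"
    then show "i = k"
      using assms pairs_nth_eq_iff[of i n k] by (simp add: length_pairs)
  qed
  then show ?thesis
    using pairs_nthD(1)[OF assms] by (simp add: coord2_def)
qed

definition wedge :: "'a :: comm_ring vec \<Rightarrow> 'a vec \<Rightarrow> 'a vec" where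
  "wedge x y = vec (dim_vec x choose 2)
     (\<lambda>k. case pairs (dim_vec x) ! k of (c, d) \<Rightarrow> x $ c * y $ d - x $ d * y $ c)"

text \<open>The column of index \<open>{a, b}\<close> is \<open>(g e_a) \<and> (g e_b)\<close>, where \<open>g e_a\<close> is
  written \<open>col g a\<close>.\<close>

definition ext_square :: "'a :: comm_ring mat \<Rightarrow> 'a mat" where
  "ext_square g = mat_of_cols (dim_row g choose 2)
     (map (\<lambda>(a, b). wedge (col g a) (col g b)) (pairs (dim_row g)))"

lemma ext_square_carrier: "g \<in> carrier_mat n n \<Longrightarrow>
    ext_square g \<in> carrier_mat (n choose 2) (n choose 2)"
  by (intro carrier_matI) (simp_all add: ext_square_def length_pairs)

lemma wedge_basis:
  assumes "k < n choose 2" "pairs n ! k = (a, b)"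
  shows "wedge (col (1\<^sub>m n) a) (col (1\<^sub>m n) b) =
    col (1\<^sub>m (n choose 2) :: 'a :: {comm_ring, comm_monoid_mult} mat) k"
proof (rule eq_vecI)
  fix i assume "i < dim_vec (col (1\<^sub>m (n choose 2) :: 'a mat) k)"
  then have i: "i < n choose 2"
    by simp
  obtain c d where cd: "pairs n ! i = (c, d)"
    by fastforce
  have conj: "(if P then 1 else 0) * (if Q then 1 else 0) = (if P \<and> Q then 1 else 0 :: 'a)"
    for P Q
    by simp
  have eq: "c = a \<and> d = b \<longleftrightarrow> i = k"
    using pairs_nth_eq_iff[OF i assms(1)] assms(2) cd by simp
  have neq: "\<not> (d = a \<and> c = b)"
    using pairs_nthD[OF i cd] pairs_nthD[OF assms] by linarith
  have "c < n" "d < n" "a < n" "b < n"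
    using pairs_nthD[OF i cd] pairs_nthD[OF assms] by linarith+
  then have "wedge (col (1\<^sub>m n) a) (col (1\<^sub>m n) b) $ i =
      (if c = a then 1 else 0) * (if d = b then 1 else 0) -
      (if d = a then 1 else 0) * (if c = b then 1 else 0 :: 'a)"
    using i cd by (simp add: wedge_def split del: if_split)
  also have "\<dots> = (if c = a \<and> d = b then 1 else 0) - (if d = a \<and> c = b then 1 else 0)"
    by (simp only: conj)
  also have "\<dots> = col (1\<^sub>m (n choose 2)) k $ i"
    unfolding eq if_not_P[OF neq] using i assms(1) by simp
  finally show "wedge (col (1\<^sub>m n) a) (col (1\<^sub>m n) b) $ i =
      (col (1\<^sub>m (n choose 2)) k :: 'a vec) $ i" .
qed (simp add: wedge_def)

lemma ext_square_wedge:
  fixes g :: "'a :: comm_ring mat"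
  assumes g: "g \<in> carrier_mat n n" and x: "x \<in> carrier_vec n" and y: "y \<in> carrier_vec n"
  shows "ext_square g *\<^sub>v wedge x y = wedge (g *\<^sub>v x) (g *\<^sub>v y)"
proof (rule eq_vecI)
  fix k assume "k < dim_vec (wedge (g *\<^sub>v x) (g *\<^sub>v y))"
  then have k: "k < n choose 2"
    using g by (simp add: wedge_def)
  obtain c d where cd: "pairs n ! k = (c, d)"
    by fastforce
  then have cdn: "c < n" "d < n"
    using pairs_nthD[OF k cd] by auto
  define m where "m = (\<lambda>a b. g $$ (c, a) * g $$ (d, b) - g $$ (d, a) * g $$ (c, b))"
  let ?L = "{(a, b). a < b \<and> b < n}" and ?G = "{(a, b). b < a \<and> a < n}"
  let ?f = "\<lambda>(a, b). m a b * (x $ a * y $ b)"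
  have L: "finite ?L"
    by (rule finite_subset[of _ "{..<n} \<times> {..<n}"]) auto
  have G: "finite ?G"
    by (rule finite_subset[of _ "{..<n} \<times> {..<n}"]) auto
  have "(ext_square g *\<^sub>v wedge x y) $ k =
      (\<Sum>l<n choose 2. (\<lambda>(a, b). m a b * (x $ a * y $ b - x $ b * y $ a)) (pairs n ! l))"
  proof -
    have "ext_square g $$ (k, l) * wedge x y $ l =
        (\<lambda>(a, b). m a b * (x $ a * y $ b - x $ b * y $ a)) (pairs n ! l)"
      if l: "l < n choose 2" for l
    proof -
      obtain a b where ab: "pairs n ! l = (a, b)"
        by fastforce
      show ?thesis
        using pairs_nthD[OF l ab] g x y k l cd cdn ab
        by (simp add: ext_square_def mat_of_cols_def wedge_def length_pairs m_def)
    qed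
    then show ?thesis
      using k x ext_square_carrier[OF g]
      by (simp add: scalar_prod_def wedge_def lessThan_atLeast0)
  qed
  also have "\<dots> = (\<Sum>(a, b)\<in>?L. m a b * (x $ a * y $ b - x $ b * y $ a))"
    using sum.reindex_bij_betw[OF bij_betw_nth[OF distinct_pairs refl refl]]
    by (simp add: length_pairs set_pairs)
  also have "\<dots> = sum ?f ?L + (\<Sum>(a, b)\<in>?L. m b a * (x $ b * y $ a))"
    unfolding sum.distrib[symmetric] by (rule sum.cong) (auto simp: m_def algebra_simps)
  also have "(\<Sum>(a, b)\<in>?L. m b a * (x $ b * y $ a)) = sum ?f ?G"
    by (rule sum.reindex_bij_witness[of _ prod.swap prod.swap]) auto
  also have "sum ?f ?L + sum ?f ?G = sum ?f (?L \<union> ?G)"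
    using L G by (intro sum.union_disjoint[symmetric]) auto
  also have "\<dots> = sum ?f ({..<n} \<times> {..<n})"
  proof (rule sum.mono_neutral_left)
    have "m a a = 0" for a
      by (simp add: m_def mult.commute)
    moreover have "a = b" if "a < n" "b < n" "(a, b) \<notin> ?L \<union> ?G" for a b
      using that by auto
    ultimately show "\<forall>i\<in>{..<n} \<times> {..<n} - (?L \<union> ?G). ?f i = 0"
      by fastforce
  qed auto
  also have "\<dots> = (\<Sum>a<n. g $$ (c, a) * x $ a) * (\<Sum>b<n. g $$ (d, b) * y $ b) -
      (\<Sum>a<n. g $$ (d, a) * x $ a) * (\<Sum>b<n. g $$ (c, b) * y $ b)"
    unfolding sum_product sum.cartesian_product sum_subtractf[symmetric]
    by (rule sum.cong) (auto simp: m_def algebra_simps)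
  also have "\<dots> = wedge (g *\<^sub>v x) (g *\<^sub>v y) $ k"
    using g x y k cd cdn by (simp add: wedge_def scalar_prod_def lessThan_atLeast0)
  finally show "(ext_square g *\<^sub>v wedge x y) $ k = wedge (g *\<^sub>v x) (g *\<^sub>v y) $ k" .
qed (use g in \<open>simp add: wedge_def ext_square_def\<close>)

lemma ext_square_mult:
  fixes g h :: "'a :: comm_ring mat"
  assumes g: "g \<in> carrier_mat n n" and h: "h \<in> carrier_mat n n"
  shows "ext_square (g * h) = ext_square g * ext_square h"
proof (rule mat_col_eqI)
  have gh: "g * h \<in> carrier_mat n n"
    using g h by (rule mult_carrier_mat)
  note dims = ext_square_carrier[OF g] ext_square_carrier[OF h] ext_square_carrier[OF gh]
  show "dim_row (ext_square (g * h)) = dim_row (ext_square g * ext_square h)"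
    and "dim_col (ext_square (g * h)) = dim_col (ext_square g * ext_square h)"
    using dims by (simp_all only: index_mult_mat carrier_matD)
  fix k assume "k < dim_col (ext_square g * ext_square h)"
  then have k: "k < n choose 2"
    using dims by (simp only: index_mult_mat carrier_matD)
  obtain a b where ab: "pairs n ! k = (a, b)"
    by fastforce
  have a: "a < n" and b: "b < n"
    using pairs_nthD[OF k ab] by simp_all
  have col_ext: "col (ext_square f) k = wedge (col f a) (col f b)"
    if f: "f \<in> carrier_mat n n" for f :: "'a mat"
  proof -
    have "wedge (col f a) (col f b) \<in> carrier_vec (n choose 2)"
      using f by (simp add: wedge_def)
    then show ?thesis
      using f k ab unfolding ext_square_def
      by (subst col_mat_of_cols) (simp_all add: length_pairs)
  qed
  have "col (ext_square g * ext_square h) k = ext_square g *\<^sub>v col (ext_square h) k"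
    using dims(1,2) k by (rule col_mult2)
  also have "\<dots> = ext_square g *\<^sub>v wedge (col h a) (col h b)"
    by (simp only: col_ext[OF h])
  also have "\<dots> = wedge (g *\<^sub>v col h a) (g *\<^sub>v col h b)"
    using a b h by (intro ext_square_wedge[OF g] col_carrier_vec)
  also have "\<dots> = wedge (col (g * h) a) (col (g * h) b)"
    by (simp only: col_mult2[OF g h a] col_mult2[OF g h b])
  also have "\<dots> = col (ext_square (g * h)) k"
    by (simp only: col_ext[OF gh])
  finally show "col (ext_square (g * h)) k = col (ext_square g * ext_square h) k" ..
qed

definition transvection ::
    "nat \<Rightarrow> nat \<Rightarrow> nat \<Rightarrow> 'a :: {comm_ring, comm_monoid_mult} \<Rightarrow> 'a mat" where
  "transvection n i j \<xi> =
     1\<^sub>m n + \<xi> \<cdot>\<^sub>m mat n n (\<lambda>(r, c). if r = i \<and> c = j then 1 else 0)"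

definition pair_sgn :: "nat \<Rightarrow> nat \<Rightarrow> 'a :: {comm_ring, comm_monoid_mult}" where
  "pair_sgn s j = (if s < j then 1 else - 1)"

text \<open>The list \<open>ss\<close> gives the order of the factors; it is meant to enumerate
  \<open>{..<n} - {j}\<close> without repetition.\<close>

definition T_star ::
    "nat \<Rightarrow> 'a :: {comm_ring, comm_monoid_mult} vec \<Rightarrow> nat \<Rightarrow> nat list \<Rightarrow> 'a mat" where
  "T_star n w j ss =
     foldr (*)
       (map (\<lambda>s. ext_square (transvection n s j (pair_sgn s j * coord2 n w s j))) ss)
       (1\<^sub>m (n choose 2))"

end

theory Submission
  imports Defs
begin

text \<open>
  A vector \<open>w\<close> of the exterior square is the same thing as an alternating matrix \<open>W\<close>, whose
  entries above the diagonal are the coordinates of \<open>w\<close>. Under this identification the exterior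
  square of \<open>g\<close> acts as the congruence \<open>g W g\<^sup>T\<close> (\<open>skew_coord_ext_square\<close>), and
  \<open>sgn(s,j) w\<^sub>s\<^sub>j\<close> is the entry \<open>W\<^sub>s\<^sub>j\<close>.

  The product of the transvections in the definition of \<open>T\<^sub>*\<^sub>,\<^sub>j\<close> is therefore \<open>g = e + u e\<^sub>j\<^sup>T\<close>,
  where \<open>u\<close> is column \<open>j\<close> of \<open>W\<close>; row \<open>j\<close> of \<open>W\<close> is \<open>- u\<^sup>T\<close>, and the diagonal entry
  \<open>W\<^sub>j\<^sub>j\<close> vanishes. Hence
  \<open>g W g\<^sup>T = W + u (e\<^sub>j\<^sup>T W) + (W e\<^sub>j) u\<^sup>T + u W\<^sub>j\<^sub>j u\<^sup>T = W - u u\<^sup>T + u u\<^sup>T = W\<close>.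

  The product is evaluated factor by factor. A transvection \<open>t\<^sub>s\<^sub>,\<^sub>j\<close> with \<open>s \<noteq> j\<close> changes
  only row and column \<open>s\<close>, by multiples of row and column \<open>j\<close>, whereas the entries of row and
  column \<open>j\<close> keep their values because \<open>W\<^sub>j\<^sub>j = 0\<close>. So the contributions of the factors
  simply add up, in whatever order they are taken (\<open>skew_coord_T_star\<close>).
\<close>

definition skew_coord :: "nat \<Rightarrow> 'a :: comm_ring vec \<Rightarrow> nat \<Rightarrow> nat \<Rightarrow> 'a" where
  "skew_coord n w a b =
     (if a < b then coord2 n w a b else if b < a then - coord2 n w a b else 0)"

lemma skew_coord_self [simp]: "skew_coord n w a a = 0"
  by (simp add: skew_coord_def)

lemma skew_coord_swap: "skew_coord n w b a = - skew_coord n w a b"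
  by (simp add: skew_coord_def coord2_commute[of n w b a])

lemma skew_coord_nth:
  assumes "k < n choose 2" "pairs n ! k = (a, b)"
  shows "skew_coord n w a b = w $ k"
  using coord2_nth[OF assms] pairs_nthD(1)[OF assms] by (simp add: skew_coord_def)

lemma pairs_index_exists:
  assumes "a < b" "b < n"
  obtains k where "k < n choose 2" "pairs n ! k = (a, b)"
  using assms by (metis (mono_tags, lifting) case_prodI in_set_conv_nth length_pairs
      mem_Collect_eq set_pairs)

lemma vec_eq_if_skew_coord_eq:
  assumes "v \<in> carrier_vec (n choose 2)" "w \<in> carrier_vec (n choose 2)"
    and eq: "\<And>a b. a < n \<Longrightarrow> b < n \<Longrightarrow> skew_coord n v a b = skew_coord n w a b"
  shows "v = w"
proof (rule eq_vecI)
  fix k assume "k < dim_vec w"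
  then have k: "k < n choose 2"
    using assms(2) by simp
  obtain a b where ab: "pairs n ! k = (a, b)"
    by fastforce
  have "a < n" "b < n"
    using pairs_nthD[OF k ab] by simp_all
  then show "v $ k = w $ k"
    using eq skew_coord_nth[OF k ab] by metis
qed (use assms in simp)

text \<open>Both orders of an off-diagonal index pair contribute to the bilinear expression; as the
  form is alternating, they combine into one \<open>2 \<times> 2\<close> minor.\<close>

lemma skew_bilinear_eq_sum_minors:
  fixes A :: "nat \<Rightarrow> nat \<Rightarrow> 'a :: comm_ring"
  assumes self: "\<And>a. A a a = 0" and swap: "\<And>a b. A b a = - A a b"
  shows "(\<Sum>a<n. \<Sum>b<n. p a * q b * A a b) =
    (\<Sum>(a, b) | a < b \<and> b < n. (p a * q b - p b * q a) * A a b)"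
proof -
  let ?L = "{(a, b). a < b \<and> b < n}" and ?G = "{(a, b). b < a \<and> a < n}"
  let ?f = "\<lambda>(a, b). p a * q b * A a b"
  have L: "finite ?L" and G: "finite ?G"
    by (rule finite_subset[of _ "{..<n} \<times> {..<n}"]; auto)+
  have "(\<Sum>a<n. \<Sum>b<n. p a * q b * A a b) = sum ?f ({..<n} \<times> {..<n})"
    by (simp add: sum.cartesian_product)
  also have "\<dots> = sum ?f (?L \<union> ?G)"
  proof (rule sum.mono_neutral_right)
    show "\<forall>i\<in>{..<n} \<times> {..<n} - (?L \<union> ?G). ?f i = 0"
      using self by (force simp: not_less_iff_gr_or_eq)
  qed auto
  also have "\<dots> = sum ?f ?L + sum ?f ?G"
    using L G by (intro sum.union_disjoint) auto
  also have "sum ?f ?G = (\<Sum>(a, b)\<in>?L. p b * q a * A b a)"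
    by (rule sum.reindex_bij_witness[of _ prod.swap prod.swap]) auto
  also have "sum ?f ?L + \<dots> = (\<Sum>(a, b)\<in>?L. (p a * q b - p b * q a) * A a b)"
    unfolding sum.distrib[symmetric]
  proof (rule sum.cong)
    have "p a * q b * A a b + p b * q a * A b a = (p a * q b - p b * q a) * A a b" for a b
      by (subst swap) (simp add: left_diff_distrib)
    then show "(case i of (a, b) \<Rightarrow> p a * q b * A a b) + (case i of (a, b) \<Rightarrow> p b * q a * A b a) =
        (case i of (a, b) \<Rightarrow> (p a * q b - p b * q a) * A a b)" for i
      by (simp add: split_beta)
  qed simp
  finally show ?thesis .
qed

text \<open>The double sum is the entry of \<open>g W g\<^sup>T\<close> at \<open>(c, d)\<close>. For \<open>c < d\<close> the equation holds because
  the entries of the exterior square of \<open>g\<close> are the \<open>2 \<times> 2\<close> minors of \<open>g\<close>; the other cases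
  follow since both sides are alternating in \<open>c\<close> and \<open>d\<close>.\<close>

lemma skew_coord_ext_square:
  fixes g :: "'a :: comm_ring mat"
  assumes g: "g \<in> carrier_mat n n" and w: "w \<in> carrier_vec (n choose 2)"
    and "c < n" "d < n"
  shows "skew_coord n (ext_square g *\<^sub>v w) c d =
    (\<Sum>a<n. \<Sum>b<n. g $$ (c, a) * g $$ (d, b) * skew_coord n w a b)"
proof -
  let ?S = "\<lambda>c d. \<Sum>(a, b) | a < b \<and> b < n.
    (g $$ (c, a) * g $$ (d, b) - g $$ (c, b) * g $$ (d, a)) * skew_coord n w a b"
  have upper: "skew_coord n (ext_square g *\<^sub>v w) c d = ?S c d" if "c < d" "d < n" for c d
  proof -
    obtain k where k: "k < n choose 2" and cd: "pairs n ! k = (c, d)"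
      using pairs_index_exists \<open>c < d\<close> \<open>d < n\<close> by blast
    have "ext_square g $$ (k, l) * w $ l =
        (\<lambda>(a, b). (g $$ (c, a) * g $$ (d, b) - g $$ (c, b) * g $$ (d, a)) *
          skew_coord n w a b) (pairs n ! l)"
      if l: "l < n choose 2" for l
    proof -
      obtain a b where ab: "pairs n ! l = (a, b)"
        by fastforce
      show ?thesis
        using pairs_nthD[OF l ab] g k l cd \<open>c < d\<close> \<open>d < n\<close> ab skew_coord_nth[OF l ab, of w]
        by (simp add: ext_square_def mat_of_cols_def wedge_def length_pairs mult.commute)
    qed
    then have "(ext_square g *\<^sub>v w) $ k = (\<Sum>l<n choose 2.
        (\<lambda>(a, b). (g $$ (c, a) * g $$ (d, b) - g $$ (c, b) * g $$ (d, a)) *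
          skew_coord n w a b) (pairs n ! l))"
      using k w ext_square_carrier[OF g] by (simp add: scalar_prod_def lessThan_atLeast0)
    also have "\<dots> = ?S c d"
      using sum.reindex_bij_betw[OF bij_betw_nth[OF distinct_pairs refl refl]]
      by (simp add: length_pairs set_pairs)
    finally show ?thesis
      by (simp add: skew_coord_nth[OF k cd])
  qed
  have swap: "?S c d = - ?S d c"
    unfolding sum_negf[symmetric] by (rule sum.cong) (auto simp: algebra_simps)
  have "skew_coord n (ext_square g *\<^sub>v w) c d = ?S c d"
  proof (cases c d rule: linorder_cases)
    case less
    then show ?thesis
      using \<open>d < n\<close> by (rule upper)
  next
    case equal
    then show ?thesis
      by (simp add: mult.commute)
  next
    case greater
    have "skew_coord n (ext_square g *\<^sub>v w) c d = - skew_coord n (ext_square g *\<^sub>v w) d c"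
      by (rule skew_coord_swap)
    also have "\<dots> = ?S c d"
      unfolding upper[OF greater \<open>c < n\<close>] by (rule swap[symmetric])
    finally show ?thesis .
  qed
  also have "\<dots> = (\<Sum>a<n. \<Sum>b<n. g $$ (c, a) * g $$ (d, b) * skew_coord n w a b)"
    by (rule skew_bilinear_eq_sum_minors[symmetric]) (rule skew_coord_self, rule skew_coord_swap)
  finally show ?thesis .
qed

lemma transvection_carrier: "transvection n i j \<xi> \<in> carrier_mat n n"
  by (simp add: transvection_def)

lemma sum_transvection_row:
  fixes f :: "nat \<Rightarrow> 'a :: {comm_ring, comm_monoid_mult}"
  assumes "j < n" "c < n"
  shows "(\<Sum>a<n. transvection n s j \<xi> $$ (c, a) * f a) = f c + (if c = s then \<xi> * f j else 0)"
proof -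
  have "transvection n s j \<xi> $$ (c, a) * f a =
      (if a = c then f a else 0) + (if a = j then if c = s then \<xi> * f a else 0 else 0)"
    if "a < n" for a
    using that assms by (simp add: transvection_def distrib_right)
  then have "(\<Sum>a<n. transvection n s j \<xi> $$ (c, a) * f a) =
      (\<Sum>a<n. (if a = c then f a else 0) + (if a = j then if c = s then \<xi> * f a else 0 else 0))"
    by simp
  also have "\<dots> = f c + (if c = s then \<xi> * f j else 0)"
    using assms by (simp add: sum.distrib)
  finally show ?thesis .
qed

text \<open>The quadratic term in \<open>\<xi>\<close> is a multiple of the diagonal entry at \<open>j\<close>, which is zero.\<close>

lemma skew_coord_transvection:
  fixes w :: "'a :: {comm_ring, comm_monoid_mult} vec"
  assumes "w \<in> carrier_vec (n choose 2)" and "j < n" "c < n" "d < n"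
  shows "skew_coord n (ext_square (transvection n s j \<xi>) *\<^sub>v w) c d =
    skew_coord n w c d + (if c = s then \<xi> * skew_coord n w j d else 0) +
    (if d = s then \<xi> * skew_coord n w c j else 0)"
proof -
  let ?t = "transvection n s j \<xi>"
  have "skew_coord n (ext_square ?t *\<^sub>v w) c d =
      (\<Sum>a<n. ?t $$ (c, a) * (\<Sum>b<n. ?t $$ (d, b) * skew_coord n w a b))"
    using assms
    by (simp add: skew_coord_ext_square[OF transvection_carrier] sum_distrib_left mult.assoc)
  also have "\<dots> = skew_coord n w c d + (if d = s then \<xi> * skew_coord n w c j else 0) +
      (if c = s then \<xi> * skew_coord n w j d else 0)"
    using assms by (simp add: sum_transvection_row)
  finally show ?thesis
    by (simp add: ac_simps)
qed

lemma T_star_Nil_mult_vec: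
  assumes "v \<in> carrier_vec (n choose 2)"
  shows "T_star n w j [] *\<^sub>v v = v"
proof (rule eq_vecI)
  fix k assume "k < dim_vec v"
  then have k: "k < n choose 2"
    using assms by simp
  have "(T_star n w j [] *\<^sub>v v) $ k = (\<Sum>i<n choose 2. (if k = i then 1 else 0) * v $ i)"
    using assms k by (simp add: T_star_def scalar_prod_def lessThan_atLeast0)
  also have "\<dots> = (\<Sum>i<n choose 2. if k = i then v $ i else 0)"
    by (rule sum.cong) simp_all
  finally show "(T_star n w j [] *\<^sub>v v) $ k = v $ k"
    using k by simp
qed (use assms in \<open>simp add: T_star_def\<close>)

lemma T_star_carrier: "T_star n w j ss \<in> carrier_mat (n choose 2) (n choose 2)"
  by (induction ss)
    (auto simp: T_star_def intro!: mult_carrier_mat ext_square_carrier transvection_carrier)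

lemma T_star_Cons_mult_vec:
  assumes "v \<in> carrier_vec (n choose 2)"
  shows "T_star n w j (s # ss) *\<^sub>v v =
    ext_square (transvection n s j (pair_sgn s j * coord2 n w s j)) *\<^sub>v (T_star n w j ss *\<^sub>v v)"
proof -
  have "T_star n w j (s # ss) =
      ext_square (transvection n s j (pair_sgn s j * coord2 n w s j)) * T_star n w j ss"
    by (simp add: T_star_def)
  then show ?thesis
    using assoc_mult_mat_vec[OF ext_square_carrier[OF transvection_carrier] T_star_carrier assms]
    by simp
qed

lemma pair_sgn_mult_coord2:
  assumes "s \<noteq> j"
  shows "pair_sgn s j * coord2 n w s j = skew_coord n w s j"
  using assms by (simp add: pair_sgn_def skew_coord_def)

text \<open>No products of two coefficients occur: the factors other than the one for \<open>s\<close> see and leave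
  row and column \<open>j\<close> of the original matrix, since \<open>j\<close> is not among the indices in \<open>ss\<close>.\<close>

lemma skew_coord_T_star:
  fixes v w :: "'a :: {comm_ring, comm_monoid_mult} vec"
  assumes v: "v \<in> carrier_vec (n choose 2)" and j: "j < n"
    and "distinct ss" "j \<notin> set ss" and "c < n" "d < n"
  shows "skew_coord n (T_star n w j ss *\<^sub>v v) c d =
    skew_coord n v c d + (if c \<in> set ss then skew_coord n w c j * skew_coord n v j d else 0) +
    (if d \<in> set ss then skew_coord n w d j * skew_coord n v c j else 0)"
  using assms(3-)
proof (induction ss arbitrary: c d)
  case Nil
  then show ?case
    by (simp add: T_star_Nil_mult_vec[OF v])
next
  case (Cons s ss)
  let ?u = "T_star n w j ss *\<^sub>v v"
  have u: "?u \<in> carrier_vec (n choose 2)"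
    using T_star_carrier v by (rule mult_mat_vec_carrier)
  have s: "s \<noteq> j" "s \<notin> set ss" "j \<notin> set ss" "distinct ss"
    using Cons.prems by auto
  have IH: "skew_coord n ?u a b = skew_coord n v a b +
      (if a \<in> set ss then skew_coord n w a j * skew_coord n v j b else 0) +
      (if b \<in> set ss then skew_coord n w b j * skew_coord n v a j else 0)"
    if "a < n" "b < n" for a b
    using Cons.IH that s by blast
  have "skew_coord n (T_star n w j (s # ss) *\<^sub>v v) c d = skew_coord n ?u c d +
      (if c = s then skew_coord n w s j * skew_coord n ?u j d else 0) +
      (if d = s then skew_coord n w s j * skew_coord n ?u c j else 0)"
    using Cons.prems s j
    by (simp add: T_star_Cons_mult_vec[OF v] pair_sgn_mult_coord2 skew_coord_transvection[OF u])
  also have "skew_coord n ?u j d = skew_coord n v j d"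
    using IH[OF j \<open>d < n\<close>] s by simp
  also have "skew_coord n ?u c j = skew_coord n v c j"
    using IH[OF \<open>c < n\<close> j] s by simp
  finally show ?case
    using IH[OF \<open>c < n\<close> \<open>d < n\<close>] s by auto
qed

theorem theorem3:
  fixes w :: "'a :: {comm_ring, comm_monoid_mult} vec" and n j :: nat and ss :: "nat list"
  assumes "n \<ge> 3"
    and "w \<in> carrier_vec (n choose 2)"
    and "j < n"
    and "distinct ss" and "set ss = {..<n} - {j}"
  shows "T_star n w j ss *\<^sub>v w = w"
proof (rule vec_eq_if_skew_coord_eq)
  show "T_star n w j ss *\<^sub>v w \<in> carrier_vec (n choose 2)"
    using T_star_carrier assms(2) by (rule mult_mat_vec_carrier)
next
  fix c d assume cd: "c < n" "d < n"
  let ?W = "skew_coord n w"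
  have "?W c j * ?W j d + ?W d j * ?W c j = 0"
    by (simp add: skew_coord_swap[of n w j d] mult.commute)
  \<comment> \<open>This is the sum of both correction terms for \<open>c, d \<noteq> j\<close>. If \<open>c = j\<close> or \<open>d = j\<close>, then
    each correction term that is left has the factor \<open>?W j j = 0\<close>.\<close>
  then show "skew_coord n (T_star n w j ss *\<^sub>v w) c d = ?W c d"
    using cd assms by (auto simp: skew_coord_T_star add.assoc)
qed (rule assms(2))

end
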